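(* For all integers $n\ge1$ and $1\le k\le n$, $$\sum_{j=k}^{n}E_j\left(1,\tfrac12,\dots,\tfrac1n\right)S(j,k)=\frac{1}{k!}\binom{n}{k},$$ where $E_j$ is the $j$-th elementary symmetric function in $n$ variables and $S(j,k)$ is the Stirling number of the second kind.
   Context: $S(j,k)$ is the number of partitions of a $j$-element set into $k$ nonempty subsets. *)

theory Defs
  imports Complex_Main "HOL-Library.Disjoint_Sets"
begin

(* Variables are x 1, ..., x n; values of x outside {1..n} are irrelevant. *)
definition elem_sym :: "nat \<Rightarrow> nat \<Rightarrow> (nat \<Rightarrow> 'a::comm_semiring_1) \<Rightarrow> 'a" where
  "elem_sym j n x = (\<Sum>I | I \<subseteq> {1..n} \<and> card I = j. \<Prod>i\<in>I. x i)"

(* The counting definition; the constant Stirling of HOL-Combinatorics is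
   instead given by the recurrence. *)
definition stirling2 :: "nat \<Rightarrow> nat \<Rightarrow> nat" where
  "stirling2 j k = card {P. partition_on {1..j} P \<and> card P = k}"

end

(* Write F n k for the left-hand side. The recurrences of elem_sym in n and of
   the Stirling numbers in j combine to
     F (n+1) k = F n k + (k * F n k + F n (k-1)) / (n+1),
   and binomial n k / k! satisfies the same recurrence, because
   k * binomial (n+1) k = (n+1) * binomial n (k-1). *)

theory Submission
  imports Defs "HOL-Combinatorics.Stirling"
begin

section \<open>Set partitions and the Stirling recurrence\<close>

text \<open>The ground set is arbitrary here, so that the recurrence can be proved by adjoining any
  fresh element, with no arithmetic on intervals.\<close>

definition partitions_into :: "'a set \<Rightarrow> nat \<Rightarrow> 'a set set set" where
  "partitions_into A k = {P. partition_on A P \<and> card P = k}"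

lemma finite_partitions_into: "finite A \<Longrightarrow> finite (partitions_into A k)"
  unfolding partitions_into_def
  by (rule finite_subset[OF _ finitely_many_partition_on[of A]]) auto

text \<open>The other blocks partition \<open>A - B\<close>, and this complement is unchanged when a
  fresh \<open>a\<close> is added to both \<open>A\<close> and \<open>B\<close>.\<close>

lemma partition_on_enlarge_block:
  assumes "partition_on A Q" "B \<in> Q" "a \<notin> A"
  shows "partition_on (insert a A) (insert (insert a B) (Q - {B}))"
proof -
  have "partition_on (A - B) (Q - {B})"
    using assms partition_on_insert[of B "Q - {B}" A]
    by (auto simp: insert_absorb partition_on_def disjnt_iff disjoint_def)
  moreover have "insert a A - insert a B = A - B"
    using assms by auto
  moreover have "disjnt (insert a B) (\<Union>(Q - {B}))" "B \<subseteq> A"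
    using assms by (auto simp: partition_on_def disjnt_iff disjoint_def)
  ultimately show ?thesis
    by (subst partition_on_insert) auto
qed

text \<open>This undoes the enlargement of a block. The condition \<open>C \<noteq> {a}\<close>
  keeps the shrunken block nonempty.\<close>

lemma partition_on_shrink_block:
  assumes "partition_on (insert a A) P" "C \<in> P" "a \<in> C" "C \<noteq> {a}" "a \<notin> A"
  shows "partition_on A (insert (C - {a}) (P - {C}))"
proof -
  have disj: "disjnt C (\<Union>(P - {C}))" and CA: "C \<subseteq> insert a A"
    using assms by (auto simp: partition_on_def disjnt_iff disjoint_def)
  have "partition_on (insert a A - C) (P - {C})"
    using assms disj partition_on_insert[of C "P - {C}" "insert a A"]
    by (auto simp: insert_absorb)
  moreover have "insert a A - C = A - (C - {a})"
    using assms by auto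
  moreover have "disjnt (C - {a}) (\<Union>(P - {C}))"
    using disj by (auto simp: disjnt_iff)
  ultimately show ?thesis
    using CA assms by (subst partition_on_insert) auto
qed

text \<open>Classify by the block containing \<open>a\<close>. If it is \<open>{a}\<close>, removing
  it loses one block; otherwise deleting \<open>a\<close> keeps the number of blocks, and the
  partition is recovered from the result together with a marked block \<open>B\<close>.\<close>

lemma partitions_into_insert:
  assumes "finite A" "a \<notin> A"
  shows "partitions_into (insert a A) (Suc k) =
    insert {a} ` partitions_into A k \<union>
    (\<lambda>(Q, B). insert (insert a B) (Q - {B})) ` (SIGMA Q:partitions_into A (Suc k). Q)"
    (is "?L = ?S \<union> ?T")
proof (intro equalityI subsetI)
  fix P assume "P \<in> ?L"
  then have P: "partition_on (insert a A) P" "card P = Suc k"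
    by (auto simp: partitions_into_def)
  then have fin: "finite P"
    by (simp add: card_ge_0_finite)
  obtain C where C: "C \<in> P" "a \<in> C"
    using P by (auto simp: partition_on_def)
  show "P \<in> ?S \<union> ?T"
  proof (cases "C = {a}")
    case True
    have "disjnt C (\<Union>(P - {C}))"
      using P C by (auto simp: partition_on_def disjnt_iff disjoint_def)
    then have "partition_on (insert a A - {a}) (P - {{a}})"
      using P C True partition_on_insert[of C "P - {C}" "insert a A"]
      by (auto simp: insert_absorb)
    moreover have "insert a A - {a} = A"
      using assms by auto
    ultimately have "P - {{a}} \<in> partitions_into A k"
      using P C True fin by (auto simp: partitions_into_def)
    moreover have "P = insert {a} (P - {{a}})"
      using C True by auto
    ultimately show ?thesis by blast
  next
    case False
    let ?B = "C - {a}"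
    let ?Q = "insert ?B (P - {C})"
    have "partition_on A ?Q"
      by (rule partition_on_shrink_block) (use P C False assms in auto)
    \<comment> \<open>Were the shrunken block already present, \<open>?Q\<close> would have one
      block too few. But it is a nonempty subset of \<open>C\<close>, so it cannot be another block
      of \<open>P\<close>.\<close>
    moreover have notin: "?B \<notin> P"
    proof
      assume "?B \<in> P"
      moreover have "?B \<noteq> C"
        using C by auto
      ultimately have "?B \<inter> C = {}"
        using disjointD[OF partition_onD2[OF P(1)]] C by metis
      with False C show False by auto
    qed
    ultimately have "?Q \<in> partitions_into A (Suc k)"
      using P C fin by (auto simp: partitions_into_def card_insert_if)
    moreover have "P = insert (insert a ?B) (?Q - {?B})"
      using notin C by (auto simp: insert_absorb)
    ultimately have "P \<in> ?T" by (intro image_eqI[of _ _ "(?Q, ?B)"]) auto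
    then show ?thesis ..
  qed
next
  fix P assume "P \<in> ?S \<union> ?T"
  then show "P \<in> ?L"
  proof
    assume "P \<in> ?S"
    then obtain Q where Q: "partition_on A Q" "card Q = k" "P = insert {a} Q"
      by (auto simp: partitions_into_def)
    have "finite Q" "{a} \<notin> Q"
      using Q assms finite_elements by (auto simp: partition_on_def)
    moreover have "disjnt {a} (\<Union>Q)"
      using Q assms by (auto simp: partition_on_def)
    ultimately show ?thesis
      using Q assms by (auto simp: partitions_into_def partition_on_insert)
  next
    assume "P \<in> ?T"
    then obtain Q B where Q: "partition_on A Q" "card Q = Suc k" "B \<in> Q"
      "P = insert (insert a B) (Q - {B})"
      by (auto simp: partitions_into_def)
    have "finite Q" "insert a B \<notin> Q"
      using Q assms finite_elements by (auto simp: partition_on_def)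
    then show ?thesis
      using Q assms partition_on_enlarge_block[of A Q B a]
      by (auto simp: partitions_into_def card_insert_if)
  qed
qed

text \<open>No block of the original partition contains \<open>a\<close>, so the enlarged block is
  the only one that does. It reveals \<open>B\<close>, and the remaining blocks then reveal
  \<open>Q\<close>.\<close>

lemma inj_on_enlarge_block:
  assumes "a \<notin> A"
  shows "inj_on (\<lambda>(Q, B). insert (insert a B) (Q - {B})) (SIGMA Q:{Q. partition_on A Q}. Q)"
proof (rule inj_onI, clarify)
  fix Q B Q' B'
  assume Q: "partition_on A Q" "B \<in> Q" and Q': "partition_on A Q'" "B' \<in> Q'"
    and eq: "insert (insert a B) (Q - {B}) = insert (insert a B') (Q' - {B'})"
  have notin: "a \<notin> X" if "X \<in> Q \<union> Q'" for X
    using that Q Q' assms by (auto simp: partition_on_def)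
  have "insert a B = insert a B'"
    using eq notin by blast
  then have B: "B = B'"
    using notin Q Q' by (metis Un_iff insert_ident)
  moreover have "Q - {B} = Q' - {B'}"
    using eq notin B by (metis Diff_iff Un_iff insertI1 insert_ident)
  ultimately show "Q = Q' \<and> B = B'"
    using Q Q' by (metis insert_Diff)
qed

text \<open>Both maps of the classification are injective with disjoint images, and each partition
  into \<open>Suc k\<close> blocks offers \<open>Suc k\<close> choices of the marked block.\<close>

lemma card_partitions_into_insert:
  assumes "finite A" "a \<notin> A"
  shows "card (partitions_into (insert a A) (Suc k)) =
    card (partitions_into A k) + Suc k * card (partitions_into A (Suc k))"
proof -
  let ?T = "SIGMA Q:partitions_into A (Suc k). Q"
  let ?f = "\<lambda>(Q, B). insert (insert a B) (Q - {B})"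
  have notin: "a \<notin> X" if "X \<in> Q" "Q \<in> partitions_into A m" for X Q m
    using that assms by (auto simp: partitions_into_def partition_on_def)
  have fin: "finite Q" if "Q \<in> partitions_into A m" for Q m
    using that assms finite_elements by (auto simp: partitions_into_def)
  have "inj_on (insert {a}) (partitions_into A k)"
  proof (rule inj_onI)
    fix Q R assume *: "Q \<in> partitions_into A k" "R \<in> partitions_into A k"
      "insert {a} Q = insert {a} R"
    then have "{a} \<notin> Q" "{a} \<notin> R"
      using notin[of "{a}"] by auto
    with * show "Q = R" by (simp add: insert_ident)
  qed
  then have S: "card (insert {a} ` partitions_into A k) = card (partitions_into A k)"
    by (rule card_image)
  have "inj_on ?f ?T"
    by (rule inj_on_subset[OF inj_on_enlarge_block[OF assms(2)]])
      (auto simp: partitions_into_def)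
  then have "card (?f ` ?T) = card ?T"
    by (rule card_image)
  also have "\<dots> = (\<Sum>Q\<in>partitions_into A (Suc k). card Q)"
    using assms fin by (intro card_SigmaI) (auto simp: finite_partitions_into)
  also have "\<dots> = Suc k * card (partitions_into A (Suc k))"
    by (simp add: partitions_into_def)
  finally have T: "card (?f ` ?T) = Suc k * card (partitions_into A (Suc k))" .
  \<comment> \<open>On the right the block containing \<open>a\<close> is \<open>insert a B\<close>
    with \<open>B\<close> nonempty, so \<open>{a}\<close> never occurs there.\<close>
  have "insert {a} ` partitions_into A k \<inter> ?f ` ?T = {}"
  proof -
    have False if "Q \<in> partitions_into A k" "R \<in> partitions_into A (Suc k)" "B \<in> R"
      "insert {a} Q = insert (insert a B) (R - {B})" for Q R B
    proof -
      have "{a} \<notin> R"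
        using notin[of "{a}" R] that by auto
      moreover have "{a} \<in> insert (insert a B) (R - {B})"
        using that(4) by (metis insertI1)
      ultimately have "{a} = insert a B"
        by auto
      moreover have "a \<notin> B"
        using notin that by metis
      moreover have "B \<noteq> {}"
        using that by (auto simp: partitions_into_def partition_on_def)
      ultimately show False by auto
    qed
    then show ?thesis by (auto simp: image_iff)
  qed
  moreover have "finite ?T"
    by (rule finite_SigmaI) (use assms fin finite_partitions_into in auto)
  ultimately have "card (insert {a} ` partitions_into A k \<union> ?f ` ?T) =
    card (insert {a} ` partitions_into A k) + card (?f ` ?T)"
    using assms by (intro card_Un_disjoint finite_imageI finite_partitions_into)
  then show ?thesis
    by (simp only: partitions_into_insert[OF assms] S T)
qed

text \<open>The induction follows the defining equations of \<open>Stirling\<close>: three boundary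
  cases, then the recurrence obtained by adjoining \<open>Suc n\<close> to
  \<open>{1..n}\<close>.\<close>

lemma stirling2_eq_Stirling: "stirling2 n k = Stirling n k"
proof (induction n k rule: Stirling.induct)
  case 1
  have "{P. partition_on {1..0::nat} P \<and> card P = 0} = {{}}"
    by (auto simp: partition_on_empty)
  then show ?case by (simp add: stirling2_def)
next
  case (2 k)
  have "{P. partition_on {1..0::nat} P \<and> card P = Suc k} = {}"
    by (auto simp: partition_on_empty)
  then show ?case by (simp only: stirling2_def card.empty Stirling.simps)
next
  case (3 n)
  have "{P. partition_on {1..Suc n} P \<and> card P = 0} = {}"
  proof -
    have "card P \<noteq> 0" if P: "partition_on {1..Suc n} P" for P
    proof -
      \<comment> \<open>Finiteness matters because \<open>card\<close> of an infinite set is 0 by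
        convention.\<close>
      have "finite P"
        using P finite_elements by blast
      moreover have "P \<noteq> {}"
        using partition_onD1[OF P] by auto
      ultimately show ?thesis by simp
    qed
    then show ?thesis by blast
  qed
  then show ?case by (simp only: stirling2_def card.empty Stirling.simps)
next
  case (4 n k)
  have "{1..Suc n} = insert (Suc n) {1..n}"
    by auto
  then have "stirling2 (Suc n) (Suc k) = stirling2 n k + Suc k * stirling2 n (Suc k)"
    using card_partitions_into_insert[of "{1..n}" "Suc n" k]
    by (simp add: stirling2_def partitions_into_def)
  then show ?case using 4 by simp
qed

section \<open>Recurrences for elementary symmetric functions\<close>

lemma elem_sym_0: "elem_sym 0 n x = 1"
proof -
  have "{I. I \<subseteq> {1..n} \<and> card I = 0} = {{}}"
    by (auto dest: finite_subset)
  then show ?thesis by (simp add: elem_sym_def)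
qed

lemma elem_sym_eq_0: "n < j \<Longrightarrow> elem_sym j n x = 0"
proof -
  assume "n < j"
  then have "{I. I \<subseteq> {1..n} \<and> card I = j} = {}"
    using card_mono[OF finite_atLeastAtMost, of _ 1 n] by (auto simp: not_le[symmetric])
  then show ?thesis by (simp only: elem_sym_def sum.empty)
qed

text \<open>Split the index sets by whether they contain \<open>Suc n\<close>.\<close>

lemma elem_sym_Suc_Suc:
  "elem_sym (Suc j) (Suc n) x = elem_sym (Suc j) n x + x (Suc n) * elem_sym j n x"
proof -
  let ?A = "\<lambda>j. {I. I \<subseteq> {1..n} \<and> card I = j}"
  have fin: "finite I" if "I \<subseteq> {1..n}" for I
    using that finite_subset by blast
  have finA: "finite (?A i)" for i
    by (rule finite_subset[of _ "Pow {1..n}"]) auto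
  have "{I. I \<subseteq> {1..Suc n} \<and> card I = Suc j} = ?A (Suc j) \<union> insert (Suc n) ` ?A j"
  proof (intro equalityI subsetI)
    fix I assume I: "I \<in> {I. I \<subseteq> {1..Suc n} \<and> card I = Suc j}"
    show "I \<in> ?A (Suc j) \<union> insert (Suc n) ` ?A j"
    proof (cases "Suc n \<in> I")
      case True
      then have "I - {Suc n} \<in> ?A j"
        using I by (auto simp: atLeastAtMostSuc_conv)
      moreover have "I = insert (Suc n) (I - {Suc n})"
        using True by auto
      ultimately show ?thesis by blast
    next
      case False
      then show ?thesis using I by (auto simp: atLeastAtMostSuc_conv)
    qed
  next
    fix I assume "I \<in> ?A (Suc j) \<union> insert (Suc n) ` ?A j"
    then show "I \<in> {I. I \<subseteq> {1..Suc n} \<and> card I = Suc j}"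
    proof
      assume "I \<in> insert (Suc n) ` ?A j"
      then obtain J where J: "J \<subseteq> {1..n}" "card J = j" "I = insert (Suc n) J"
        by auto
      moreover have "Suc n \<notin> J" using J by auto
      ultimately show ?thesis using fin[of J] by auto
    qed auto
  qed
  moreover have "?A (Suc j) \<inter> insert (Suc n) ` ?A j = {}"
    by auto
  moreover have "inj_on (insert (Suc n)) (?A j)"
  proof (rule inj_onI)
    fix I J assume "I \<in> ?A j" "J \<in> ?A j" "insert (Suc n) I = insert (Suc n) J"
    moreover have "Suc n \<notin> I" "Suc n \<notin> J"
      using calculation by auto
    ultimately show "I = J" by (simp add: insert_ident)
  qed
  moreover have "(\<Prod>i\<in>insert (Suc n) I. x i) = x (Suc n) * (\<Prod>i\<in>I. x i)" if "I \<in> ?A j" for I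
  proof -
    have "Suc n \<notin> I" using that by auto
    then show ?thesis using that fin by simp
  qed
  ultimately show ?thesis
    using finA by (simp add: elem_sym_def sum.union_disjoint sum.reindex sum_distrib_left)
qed

text \<open>The sum is the image of the product of all \<open>1 + x i * t\<close> under the linear
  map sending \<open>t^j\<close> to \<open>f j\<close>. The new factor
  \<open>1 + x (Suc n) * t\<close> contributes one unshifted and one shifted sum.\<close>

lemma sum_elem_sym_mult_Suc:
  fixes x f :: "nat \<Rightarrow> 'a::comm_semiring_1"
  shows "(\<Sum>j\<le>Suc n. elem_sym j (Suc n) x * f j) =
    (\<Sum>j\<le>n. elem_sym j n x * f j) + x (Suc n) * (\<Sum>j\<le>n. elem_sym j n x * f (Suc j))"
proof -
  \<comment> \<open>The term \<open>j = 0\<close> is split off because the recurrence covers only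
    positive degrees; \<open>elem_sym 0\<close> is 1 for any number of variables.\<close>
  have "(\<Sum>j\<le>Suc n. elem_sym j (Suc n) x * f j) =
    (elem_sym 0 n x * f 0 + (\<Sum>j\<le>n. elem_sym (Suc j) n x * f (Suc j)))
    + x (Suc n) * (\<Sum>j\<le>n. elem_sym j n x * f (Suc j))"
    by (simp add: sum.atMost_Suc_shift elem_sym_0 elem_sym_Suc_Suc algebra_simps
        sum.distrib sum_distrib_left del: sum.atMost_Suc)
  also have "elem_sym 0 n x * f 0 + (\<Sum>j\<le>n. elem_sym (Suc j) n x * f (Suc j)) =
    (\<Sum>j\<le>Suc n. elem_sym j n x * f j)"
    by (simp only: sum.atMost_Suc_shift)
  also have "\<dots> = (\<Sum>j\<le>n. elem_sym j n x * f j)"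
    by (simp add: elem_sym_eq_0)
  finally show ?thesis .
qed

section \<open>Evaluation of the sum at reciprocals\<close>

text \<open>Summing from 0 and allowing every \<open>k\<close> lets the induction on
  \<open>n\<close> use the hypothesis at both \<open>k\<close> and its predecessor.\<close>

lemma sum_elem_sym_inverse_mult_Stirling:
  "(\<Sum>j\<le>n. elem_sym j n (\<lambda>i. 1 / real i) * real (Stirling j k)) = 1 / fact k * real (n choose k)"
proof (induction n arbitrary: k)
  case 0
  show ?case by (cases k) (simp_all add: elem_sym_0)
next
  case (Suc n)
  note step = sum_elem_sym_mult_Suc[of n "\<lambda>i. 1 / real i" "\<lambda>j. real (Stirling j k)"]
  show ?case
  proof (cases k)
    case 0
    \<comment> \<open>The shifted sum vanishes because
      \<open>Stirling (Suc j) 0 = 0\<close>.\<close>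
    then show ?thesis using step Suc.IH[of 0] by simp
  next
    case (Suc m)
    let ?E = "\<lambda>j. elem_sym j n (\<lambda>i. 1 / real i)"
    have "(\<Sum>j\<le>n. ?E j * real (Stirling (Suc j) k)) =
      real k * (\<Sum>j\<le>n. ?E j * real (Stirling j k)) + (\<Sum>j\<le>n. ?E j * real (Stirling j m))"
      using Suc by (simp add: sum_distrib_left sum.distrib algebra_simps)
    also have "\<dots> = real k * (1 / fact k * real (n choose k)) + 1 / fact m * real (n choose m)"
      by (simp only: Suc.IH)
    \<comment> \<open>Since \<open>k = Suc m\<close>, \<open>1 / fact m\<close> equals
      \<open>k / fact k\<close>, and Pascal's rule merges the two binomials.\<close>
    also have "\<dots> = real k / fact k * real (Suc n choose k)"
      using Suc by (simp add: field_simps del: of_nat_Suc)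
    also have "\<dots> = real (Suc n) / fact k * real (n choose m)"
    proof -
      have "real k * real (Suc n choose k) = real (Suc n) * real (n choose m)"
        using Suc_times_binomial_eq[of n m] Suc by (metis mult.commute of_nat_mult)
      then show ?thesis by simp
    qed
    \<comment> \<open>The value \<open>1 / Suc n\<close> of the new variable cancels the factor
      \<open>Suc n\<close>. Pascal's rule then adds this contribution to the induction hypothesis at
      \<open>k\<close>.\<close>
    finally have "1 / real (Suc n) * (\<Sum>j\<le>n. ?E j * real (Stirling (Suc j) k)) =
      1 / fact k * real (n choose m)"
      by simp
    then show ?thesis
      using step Suc.IH[of k] Suc by (simp add: algebra_simps add_divide_distrib)
  qed
qed

theorem mainTheorem7:
  fixes n k :: nat
  assumes "1 \<le> n" and "1 \<le> k" and "k \<le> n"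
  shows "(\<Sum>j=k..n. elem_sym j n (\<lambda>i. 1 / real i) * real (stirling2 j k))
    = 1 / fact k * real (n choose k)"
proof -
  \<comment> \<open>The added terms have \<open>j < k\<close>, where \<open>Stirling j k\<close> is
    0.\<close>
  have "(\<Sum>j=k..n. elem_sym j n (\<lambda>i. 1 / real i) * real (stirling2 j k)) =
    (\<Sum>j\<le>n. elem_sym j n (\<lambda>i. 1 / real i) * real (Stirling j k))"
    unfolding stirling2_eq_Stirling by (rule sum.mono_neutral_left) auto
  then show ?thesis
    by (simp only: sum_elem_sym_inverse_mult_Stirling)
qed

end
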